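(* Let $K$ be a field with $\mathrm{char}(K)=0$ and let $q\in K-\{0\}$ be not a root of unity. Let $\mathcal{W}_q(\mathfrak{sl}(2,K))$ (the Woronowicz algebra) be the $K$-algebra generated by $x,y,z$ subject to the relations $$xz-q^4zx=(1+q^2)x,\qquad xy-q^2yx=qz,\qquad zy-q^4yz=(1+q^2)y.$$ Then its center is trivial: $Z(\mathcal{W}_q(\mathfrak{sl}(2,K)))=K$.
   Context: The algebra is the quotient of the free associative $K$-algebra on $x,y,z$ by the stated relations; it is a skew $PBW$ extension of $K$, i.e. the monomials $x^{a}y^{b}z^{c}$ ($a,b,c\ge 0$) form a $K$-basis and elements of $K$ are central. *)

theory Defs
  imports
    "HOL-Library.Poly_Mapping"
    "HOL-Algebra.QuotRing"
    "HOL-Algebra.Algebraic_Closure_Type"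
begin

section \<open>Free associative algebras\<close>

text \<open>
  The free monoid on \<open>'a\<close>, written additively because the convolution product on
  \<^typ>\<open>'m \<Rightarrow>\<^sub>0 'k\<close> asks for an additive monoid of exponents. The wrapper type avoids imposing
  an additive structure on all lists.
\<close>

datatype 'a free_monoid = Word (letters: "'a list")

instantiation free_monoid :: (type) monoid_add
begin

definition zero_free_monoid :: "'a free_monoid"
  where "0 = Word []"

definition plus_free_monoid :: "'a free_monoid \<Rightarrow> 'a free_monoid \<Rightarrow> 'a free_monoid"
  where "u + v = Word (letters u @ letters v)"

instance
  by standard (simp_all add: zero_free_monoid_def plus_free_monoid_def)

end

text \<open>The monoid algebra of the free monoid on \<open>'a\<close> is the free associative \<open>'k\<close>-algebra on \<open>'a\<close>.\<close>

type_synonym ('a, 'k) free_algebra = "'a free_monoid \<Rightarrow>\<^sub>0 'k"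

definition scalar :: "'k \<Rightarrow> ('a, 'k::semiring_1) free_algebra"
  where "scalar c = Poly_Mapping.single 0 c"

definition gen :: "'a \<Rightarrow> ('a, 'k::semiring_1) free_algebra"
  where "gen g = Poly_Mapping.single (Word [g]) 1"

text \<open>
  The library proves this only for commutative rings. It matters here because
  \<^const>\<open>genideal\<close> is an intersection over ideals of a ring, hence is everything if there are none.
\<close>

lemma ring_ring_of_type_algebra: "ring (ring_of_type_algebra :: 'a::ring_1 ring)"
proof -
  have "\<exists>y. x + y = 0" for x :: 'a
    using add.right_inverse by blast
  thus ?thesis
    unfolding ring_of_type_algebra_def using add.right_inverse
    by unfold_locales (auto simp: algebra_simps Units_def)
qed

section \<open>The Woronowicz algebra\<close>

datatype generator = Gen_x | Gen_y | Gen_z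

definition woronowicz_relators :: "'k::field \<Rightarrow> (generator, 'k) free_algebra set"
  where "woronowicz_relators q =
    (let x = gen Gen_x; y = gen Gen_y; z = gen Gen_z in
      {(x * z - scalar (q ^ 4) * z * x) - scalar (1 + q ^ 2) * x,
       (x * y - scalar (q ^ 2) * y * x) - scalar q * z,
       (z * y - scalar (q ^ 4) * y * z) - scalar (1 + q ^ 2) * y})"

definition woronowicz_ideal :: "'k::field \<Rightarrow> (generator, 'k) free_algebra set"
  where "woronowicz_ideal q = Idl\<^bsub>ring_of_type_algebra\<^esub> (woronowicz_relators q)"

definition woronowicz :: "'k::field \<Rightarrow> (generator, 'k) free_algebra set ring"
  where "woronowicz q = ring_of_type_algebra Quot woronowicz_ideal q"

definition woronowicz_scalar :: "'k::field \<Rightarrow> 'k \<Rightarrow> (generator, 'k) free_algebra set"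
  where "woronowicz_scalar q c = woronowicz_ideal q +>\<^bsub>ring_of_type_algebra\<^esub> scalar c"

lemma ideal_woronowicz_ideal: "ideal (woronowicz_ideal q) ring_of_type_algebra"
  unfolding woronowicz_ideal_def
  by (rule ring.genideal_ideal[OF ring_ring_of_type_algebra])
     (simp add: ring_of_type_algebra_def)

lemma ring_woronowicz: "ring (woronowicz q)"
  unfolding woronowicz_def by (rule ideal.quotient_is_ring[OF ideal_woronowicz_ideal])

lemma woronowicz_scalar_hom:
  "woronowicz_scalar q \<in> ring_hom ring_of_type_algebra (woronowicz q)"
proof -
  have "scalar \<in> ring_hom ring_of_type_algebra
      (ring_of_type_algebra :: (generator, 'a) free_algebra ring)"
    by (auto simp: ring_hom_def ring_of_type_algebra_def scalar_def mult_single single_add)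
  from ring_hom_trans[OF this ideal.rcos_ring_hom[OF ideal_woronowicz_ideal]]
  show ?thesis
    by (simp add: woronowicz_def woronowicz_scalar_def[abs_def] comp_def)
qed

section \<open>The center of a ring\<close>

definition ring_center :: "('a, 'b) ring_scheme \<Rightarrow> 'a set"
  where "ring_center R =
    {u \<in> carrier R. \<forall>v \<in> carrier R. u \<otimes>\<^bsub>R\<^esub> v = v \<otimes>\<^bsub>R\<^esub> u}"

end

theory Submission
  imports Defs
begin

text \<open>
  The shift \<open>w = z - 1 / (1 - q\<^sup>2)\<close> turns the relations into \<open>x w = q\<^sup>4 w x\<close> and \<open>w y = q\<^sup>4 y w\<close>,
  and \<open>t = y x + \<alpha> w + \<beta>\<close> with suitable constants is likewise \<open>q\<close>-normal: \<open>x t = q\<^sup>2 t x\<close>,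
  \<open>t y = q\<^sup>2 y t\<close> and \<open>w t = t w\<close>. As \<open>y x\<close> and \<open>x y\<close> are affine combinations of \<open>t\<close> and \<open>w\<close>,
  the elements \<open>y\<^sup>k t\<^sup>i w\<^sup>j\<close> and \<open>t\<^sup>i w\<^sup>j x\<^sup>k\<close> span the algebra. They are linearly independent,
  because the algebra acts on a space of functions where they send one vector to distinct
  coordinate vectors. Commuting a central element with \<open>w\<close> scales a spanning element
  containing the \<open>k\<close>-th power of \<open>x\<close> or \<open>y\<close> by \<open>q\<^bsup>4k\<^esup>\<close> or its inverse, which forces \<open>k = 0\<close>;
  commuting the rest with \<open>x\<close> gives the factor \<open>q\<^bsup>2i + 4j\<^esup>\<close>, which forces \<open>i = j = 0\<close>.
\<close>

section \<open>Linear actions of free algebras\<close>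

lemma free_algebra_induct [case_names single add]:
  fixes u :: "('a, 'k::semiring_1) free_algebra"
  assumes single: "\<And>w c. P (Poly_Mapping.single w c)"
    and add: "\<And>u v. P u \<Longrightarrow> P v \<Longrightarrow> P (u + v)"
  shows "P u"
proof (induction u rule: update_induct)
  case const
  show ?case using single[of 0 0] by simp
next
  case (update u w c)
  \<comment> \<open>\<open>w\<close> is not a key of \<open>u\<close>, so overwriting its
    coefficient amounts to adding a monomial.\<close>
  have "Poly_Mapping.update w c u = Poly_Mapping.single w c + u"
    using update(1) by (intro poly_mapping_eqI)
      (auto simp: lookup_update lookup_add lookup_single when_def in_keys_iff)
  with add[OF single update(3)] show ?case by simp
qed

text \<open>With \<open>foldr\<close> the last letter acts first, so products act as compositions,
  as in a left module.\<close>

definition free_act ::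
  "('a \<Rightarrow> ('i \<Rightarrow> 'k) \<Rightarrow> 'i \<Rightarrow> 'k) \<Rightarrow> ('a, 'k::field) free_algebra \<Rightarrow> ('i \<Rightarrow> 'k) \<Rightarrow> 'i \<Rightarrow> 'k"
  where "free_act \<rho> u f p =
    (\<Sum>w\<in>Poly_Mapping.keys u. Poly_Mapping.lookup u w * foldr \<rho> (letters w) f p)"

locale linear_action =
  fixes \<rho> :: "'a \<Rightarrow> ('i \<Rightarrow> 'k) \<Rightarrow> 'i \<Rightarrow> 'k::field"
  assumes action_add: "\<rho> g (\<lambda>p. f p + h p) = (\<lambda>p. \<rho> g f p + \<rho> g h p)"
    and action_scale: "\<rho> g (\<lambda>p. c * f p) = (\<lambda>p. c * \<rho> g f p)"
begin

lemma free_act_single: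
  "free_act \<rho> (Poly_Mapping.single w c) f p = c * foldr \<rho> (letters w) f p"
  by (simp add: free_act_def)

lemma free_act_add: "free_act \<rho> (u + v) f p = free_act \<rho> u f p + free_act \<rho> v f p"
proof -
  \<comment> \<open>Padding with zero coefficients puts \<open>u\<close>, \<open>v\<close> and
    \<open>u + v\<close> on one common set of words.\<close>
  have expand: "free_act \<rho> t f p =
      (\<Sum>w\<in>Poly_Mapping.keys u \<union> Poly_Mapping.keys v. Poly_Mapping.lookup t w * foldr \<rho> (letters w) f p)"
    if "Poly_Mapping.keys t \<subseteq> Poly_Mapping.keys u \<union> Poly_Mapping.keys v" for t
    unfolding free_act_def using that
    by (intro sum.mono_neutral_left) (auto simp: in_keys_iff)
  show ?thesis
    by (simp add: expand keys_add lookup_add algebra_simps sum.distrib)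
qed

lemma free_act_uminus: "free_act \<rho> (- u) f p = - free_act \<rho> u f p"
  using free_act_add[of u "- u" f p] by (simp add: free_act_def eq_neg_iff_add_eq_0 add.commute)

lemma free_act_diff: "free_act \<rho> (u - v) f p = free_act \<rho> u f p - free_act \<rho> v f p"
  using free_act_add[of u "- v" f p] by (simp add: free_act_uminus)

lemma free_act_scalar [simp]: "free_act \<rho> (scalar c) f = (\<lambda>p. c * f p)"
  by (simp add: fun_eq_iff scalar_def free_act_single zero_free_monoid_def)

lemma free_act_one [simp]: "free_act \<rho> 1 f = f"
  using free_act_scalar[of 1 f] by (simp add: scalar_def)

lemma free_act_gen [simp]: "free_act \<rho> (gen g) f = \<rho> g f"
  by (simp add: fun_eq_iff gen_def free_act_single)

lemma free_act_sum: "free_act \<rho> (\<Sum>s\<in>S. u s) f p = (\<Sum>s\<in>S. free_act \<rho> (u s) f p)"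
  by (induction S rule: infinite_finite_induct) (simp_all add: free_act_add, simp_all add: free_act_def)

lemma word_act_add:
  "foldr \<rho> ws (\<lambda>p. f p + h p) = (\<lambda>p. foldr \<rho> ws f p + foldr \<rho> ws h p)"
  by (induction ws) (simp_all add: action_add)

lemma word_act_scale: "foldr \<rho> ws (\<lambda>p. c * f p) = (\<lambda>p. c * foldr \<rho> ws f p)"
  by (induction ws) (simp_all add: action_scale)

lemma free_act_add_right:
  "free_act \<rho> u (\<lambda>p. f p + h p) = (\<lambda>p. free_act \<rho> u f p + free_act \<rho> u h p)"
  by (induction u rule: free_algebra_induct)
    (simp_all add: fun_eq_iff free_act_single free_act_add word_act_add algebra_simps)

lemma free_act_scale_right: "free_act \<rho> u (\<lambda>p. c * f p) = (\<lambda>p. c * free_act \<rho> u f p)"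
  by (induction u rule: free_algebra_induct)
    (simp_all add: fun_eq_iff free_act_single free_act_add word_act_scale algebra_simps)

lemma free_act_mult: "free_act \<rho> (u * v) f = free_act \<rho> u (free_act \<rho> v f)"
proof (induction u rule: free_algebra_induct)
  case (single w c)
  show ?case
  proof (induction v rule: free_algebra_induct)
    case (single w' c')
    show ?case
      by (simp add: fun_eq_iff mult_single free_act_single plus_free_monoid_def word_act_scale
        free_act_scale_right mult.assoc)
  next
    case (add v v')
    have "free_act \<rho> (v + v') f = (\<lambda>p. free_act \<rho> v f p + free_act \<rho> v' f p)"
      by (simp add: fun_eq_iff free_act_add)
    with add show ?case
      by (simp add: fun_eq_iff distrib_left free_act_add free_act_add_right)
  qed
next
  case (add u u')
  then show ?case by (simp add: fun_eq_iff distrib_right free_act_add)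
qed

text \<open>With this, a generated ideal acts by zero as soon as its generators do.\<close>

lemma ideal_free_act_kernel: "ideal {u. \<forall>f p. free_act \<rho> u f p = 0} ring_of_type_algebra"
proof (rule idealI[OF ring_ring_of_type_algebra])
  interpret F: ring "ring_of_type_algebra :: ('a, 'k) free_algebra ring"
    by (rule ring_ring_of_type_algebra)
  show "subgroup {u. \<forall>f p. free_act \<rho> u f p = 0} (add_monoid ring_of_type_algebra)"
  proof (rule F.add.subgroupI)
    fix u :: "('a, 'k) free_algebra"
    assume u: "u \<in> {u. \<forall>f p. free_act \<rho> u f p = 0}"
    have "\<ominus>\<^bsub>ring_of_type_algebra\<^esub> u = - u"
      by (rule F.minus_equality) (simp_all add: ring_of_type_algebra_def)
    with u show "\<ominus>\<^bsub>ring_of_type_algebra\<^esub> u \<in> {u. \<forall>f p. free_act \<rho> u f p = 0}"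
      by (simp add: free_act_uminus)
  qed (auto simp: ring_of_type_algebra_def free_act_add intro!: exI[of _ 0],
       auto simp: free_act_def)
next
  fix a u :: "('a, 'k) free_algebra"
  assume a: "a \<in> {u. \<forall>f p. free_act \<rho> u f p = 0}"
  then have "free_act \<rho> a f = (\<lambda>p. 0)" for f by auto
  moreover have "free_act \<rho> u (\<lambda>p. 0) = (\<lambda>p. 0)"
    using free_act_scale_right[of u 0 "\<lambda>p. 0"] by simp
  ultimately show "u \<otimes>\<^bsub>ring_of_type_algebra\<^esub> a \<in> {u. \<forall>f p. free_act \<rho> u f p = 0}"
    and "a \<otimes>\<^bsub>ring_of_type_algebra\<^esub> u \<in> {u. \<forall>f p. free_act \<rho> u f p = 0}"
    by (simp_all add: ring_of_type_algebra_def free_act_mult)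
qed

end

section \<open>A faithful representation\<close>

definition shift :: "'k::field \<Rightarrow> 'k"
  where "shift q = 1 / (1 - q\<^sup>2)"

text \<open>All three follow from \<open>(1 - q\<^sup>2) * shift q = 1\<close>. The first absorbs
  the linear terms of the relations for \<open>x z\<close> and \<open>z y\<close>; the other two
  compare the coefficients of \<open>w\<close> and of \<open>1\<close> in
  \<open>x y - q\<^sup>2 y x = q z\<close>, written through \<open>t\<close> and
  \<open>w\<close>.\<close>

lemma shift_identities:
  fixes q :: "'k::field"
  assumes "q \<noteq> 0" "q\<^sup>2 \<noteq> 1"
  shows "shift q - q ^ 4 * shift q = 1 + q\<^sup>2"
    and "shift q / q * q ^ 4 = q\<^sup>2 * (shift q / q) - q"
    and "q * (shift q)\<^sup>2 = q\<^sup>2 * (q * (shift q)\<^sup>2) + q * shift q"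
proof -
  show "shift q - q ^ 4 * shift q = 1 + q\<^sup>2"
    using assms by (simp add: shift_def field_simps) algebra
  have s: "q\<^sup>2 * shift q = shift q - 1"
    using assms by (simp add: shift_def field_simps)
  have "shift q / q * q ^ 4 = q * (q\<^sup>2 * shift q)" and "q\<^sup>2 * (shift q / q) = q * shift q"
    using assms(1) by (simp_all add: eval_nat_numeral)
  then show "shift q / q * q ^ 4 = q\<^sup>2 * (shift q / q) - q"
    unfolding s by (simp only:) (simp add: algebra_simps)
  have "q\<^sup>2 * (q * (shift q)\<^sup>2) = q * shift q * (q\<^sup>2 * shift q)"
    by (simp add: power2_eq_square)
  then show "q * (shift q)\<^sup>2 = q\<^sup>2 * (q * (shift q)\<^sup>2) + q * shift q"
    unfolding s by (simp add: power2_eq_square algebra_simps)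
qed

text \<open>
  Left multiplication in coordinates: \<open>f (n, i, j)\<close> is the coefficient of \<open>t\<^sup>i w\<^sup>j x\<^sup>n\<close> if
  \<open>n \<ge> 0\<close> and of \<open>y\<^bsup>-n\<^esup> t\<^sup>i w\<^sup>j\<close> if \<open>n < 0\<close>. Negative \<open>i\<close> and \<open>j\<close> are admitted, as if \<open>t\<close> and \<open>w\<close>
  were invertible, which spares the boundary cases \<open>i = 0\<close> and \<open>j = 0\<close>.
\<close>

fun wor_act :: "'k::field \<Rightarrow> generator \<Rightarrow> (int \<times> int \<times> int \<Rightarrow> 'k) \<Rightarrow> int \<times> int \<times> int \<Rightarrow> 'k"
  where
    "wor_act q Gen_x f (n, i, j) =
      (if n > 0 then q powi (2 * i + 4 * j) * f (n - 1, i, j)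
       else q powi (2 - 2 * n) * f (n - 1, i - 1, j)
          - shift q / q * q powi (4 - 4 * n) * f (n - 1, i, j - 1)
          + q * (shift q)\<^sup>2 * f (n - 1, i, j))"
  | "wor_act q Gen_y f (n, i, j) =
      (if n < 0 then f (n + 1, i, j)
       else q powi (2 - 2 * i - 4 * j) * f (n + 1, i - 1, j)
          - shift q / q * q powi (4 - 2 * i - 4 * j) * f (n + 1, i, j - 1)
          + q * (shift q)\<^sup>2 * q powi (- 2 * i - 4 * j) * f (n + 1, i, j))"
  | "wor_act q Gen_z f (n, i, j) =
      (if n < 0 then q powi (- 4 * n) else 1) * f (n, i, j - 1) + shift q * f (n, i, j)"

interpretation wor: linear_action "wor_act q" for q :: "'k::field"
proof
  fix g and f h :: "int \<times> int \<times> int \<Rightarrow> 'k" and c :: 'k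
  show "wor_act q g (\<lambda>p. f p + h p) = (\<lambda>p. wor_act q g f p + wor_act q g h p)"
    by (cases g) (auto simp: fun_eq_iff algebra_simps add_divide_distrib)
  show "wor_act q g (\<lambda>p. c * f p) = (\<lambda>p. c * wor_act q g f p)"
    by (cases g) (auto simp: fun_eq_iff algebra_simps add_divide_distrib)
qed

lemma power_int_2_4:
  fixes q :: "'k::field"
  shows "q powi (2 * i) = (q powi i)\<^sup>2" "q powi (4 * i) = (q powi i) ^ 4"
  by (simp_all add: mult.commute[of 2] mult.commute[of 4] power_int_mult)

lemma powi_mult_cancel_left:
  fixes q :: "'k::field"
  assumes "q \<noteq> 0"
  shows "q powi a * (q powi b * t) = q powi (a + b) * t"
  using assms by (simp flip: mult.assoc add: power_int_add)

text \<open>\<open>y\<close> reads row \<open>n + 1 > 0\<close>, where the power of \<open>q\<close>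
  from \<open>x\<close> cancels the one from \<open>y\<close>. What remains is
  \<open>t - (shift q / q) w + q (shift q)\<^sup>2\<close> with \<open>t\<close> and
  \<open>w\<close> acting as pure index shifts.\<close>

lemma wor_act_YX:
  fixes q :: "'k::field"
  assumes "q \<noteq> 0" "\<not> n < 0"
  shows "wor_act q Gen_y (wor_act q Gen_x f) (n, i, j)
    = f (n, i - 1, j) - shift q / q * f (n, i, j - 1) + q * (shift q)\<^sup>2 * f (n, i, j)"
  using assms(2) by (simp add: powi_mult_cancel_left[OF assms(1)] mult.assoc)

lemma wor_act_relators:
  fixes q :: "'k::field"
  assumes "q \<noteq> 0" "q\<^sup>2 \<noteq> 1" and u: "u \<in> woronowicz_relators q"
  shows "free_act (wor_act q) u f p = 0"
proof -
  obtain n i j where p: "p = (n, i, j)" by (cases p)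
  note s = shift_identities[OF assms(1,2)]
  note powi = power_int_add power_int_diff power_int_minus power_int_2_4
  consider (xz) "u = gen Gen_x * gen Gen_z - scalar (q ^ 4) * gen Gen_z * gen Gen_x
        - scalar (1 + q\<^sup>2) * gen Gen_x"
    | (xy) "u = gen Gen_x * gen Gen_y - scalar (q\<^sup>2) * gen Gen_y * gen Gen_x - scalar q * gen Gen_z"
    | (zy) "u = gen Gen_z * gen Gen_y - scalar (q ^ 4) * gen Gen_y * gen Gen_z
        - scalar (1 + q\<^sup>2) * gen Gen_y"
    using u by (auto simp: woronowicz_relators_def Let_def)
  then show ?thesis
  proof cases
    case xz
    show ?thesis
      unfolding xz p using assms(1)
      by (simp add: wor.free_act_diff wor.free_act_mult flip: s(1),
        cases "n = - 1", auto simp: powi field_simps)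
  next
    case xy
    show ?thesis
    proof (cases "n < 0")
      case True
      define D where "D = q powi (- n)"
      have D: "q powi (2 - 2 * n) = q\<^sup>2 * D\<^sup>2" "q powi (4 - 4 * n) = q ^ 4 * D ^ 4"
        "q powi (2 - 2 * (n + 1)) = D\<^sup>2" "q powi (4 - 4 * (n + 1)) = D ^ 4"
        "q powi (- 4 * n) = D ^ 4"
        using assms(1) by (simp_all add: D_def powi power_int_mult field_simps)
      \<comment> \<open>The terms in \<open>f (n, i - 1, j)\<close> cancel, both having coefficient
        \<open>q\<^sup>2 * D\<^sup>2\<close>; the rest is grouped to match the second and third
        shift identities.\<close>
      have "free_act (wor_act q) u f p =
          (shift q / q * q ^ 4) * (- (D ^ 4)) * f (n, i, j - 1) + q * (shift q)\<^sup>2 * f (n, i, j)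
          - q\<^sup>2 * (- (shift q / q) * D ^ 4 * f (n, i, j - 1) + q * (shift q)\<^sup>2 * f (n, i, j))
          - q * (D ^ 4 * f (n, i, j - 1) + shift q * f (n, i, j))"
        unfolding xy p using True
        by (simp add: wor.free_act_diff wor.free_act_mult D[simplified] D)
          (simp add: algebra_simps diff_divide_distrib add_divide_distrib)
      also have "\<dots> = 0"
        \<comment> \<open>The left side of the third identity recurs in its right side, so it is
          applied in a single step.\<close>
        unfolding s(2) by (subst s(3)) (simp add: algebra_simps)
      finally show ?thesis .
    next
      case False
      have xy': "wor_act q Gen_x (wor_act q Gen_y f) (n, i, j) =
          q\<^sup>2 * f (n, i - 1, j) - (shift q / q * q ^ 4) * f (n, i, j - 1)
          + q * (shift q)\<^sup>2 * f (n, i, j)"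
      proof (cases "n = 0")
        case False
        define m where "m = 2 * i + 4 * j"
        have cancel: "q powi m * q powi (k - m) = q powi k" for k
          using assms(1) by (simp flip: power_int_add)
        have "wor_act q Gen_x (wor_act q Gen_y f) (n, i, j) = q powi m *
            (q powi (2 - m) * f (n, i - 1, j) - shift q / q * q powi (4 - m) * f (n, i, j - 1)
             + q * (shift q)\<^sup>2 * q powi (0 - m) * f (n, i, j))"
          using False \<open>\<not> n < 0\<close> by (simp add: m_def diff_diff_eq)
        also have "\<dots> = (q powi m * q powi (2 - m)) * f (n, i - 1, j)
            - shift q / q * (q powi m * q powi (4 - m)) * f (n, i, j - 1)
            + q * (shift q)\<^sup>2 * (q powi m * q powi (0 - m)) * f (n, i, j)"
          by (simp add: distrib_left right_diff_distrib mult.left_commute mult.assoc)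
        finally show ?thesis
          unfolding cancel by simp
      qed simp
      have "free_act (wor_act q) u f p =
          q\<^sup>2 * f (n, i - 1, j) - (shift q / q * q ^ 4) * f (n, i, j - 1)
          + q * (shift q)\<^sup>2 * f (n, i, j)
          - q\<^sup>2 * (f (n, i - 1, j) - shift q / q * f (n, i, j - 1) + q * (shift q)\<^sup>2 * f (n, i, j))
          - q * (f (n, i, j - 1) + shift q * f (n, i, j))"
        unfolding xy p using False
        by (simp add: wor.free_act_diff wor.free_act_mult xy' wor_act_YX[OF assms(1)]
          del: wor_act.simps(1,2))
      also have "\<dots> = 0"
        unfolding s(2) by (subst s(3)) (simp add: algebra_simps)
      finally show ?thesis .
    qed
  next
    case zy
    \<comment> \<open>At \<open>n = - 1\<close>, \<open>y\<close> reads row \<open>0\<close>, where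
      \<open>z\<close> switches to the factor \<open>1\<close>; hence the separate case.\<close>
    show ?thesis
      unfolding zy p using assms(1)
      by (simp add: wor.free_act_diff wor.free_act_mult flip: s(1),
        cases "n = - 1", auto simp: powi field_simps)
  qed
qed

section \<open>Computing modulo the relations\<close>

text \<open>A named multiplication by constants makes the free algebra a
  \<open>vector_space\<close>, with its \<open>span\<close>, and lets the simplifier pull constants
  out of products.\<close>

definition scale :: "'k::field \<Rightarrow> ('a, 'k) free_algebra \<Rightarrow> ('a, 'k) free_algebra"
  where "scale c u = scalar c * u"

lemma scalar_commute: "scalar c * u = u * scalar c" for u :: "('a, 'k::field) free_algebra"
  by (induction u rule: free_algebra_induct)
    (simp_all add: scalar_def mult_single algebra_simps)

lemma scalar_simps:
  "scalar (a + b) = scalar a + scalar b" "scalar (a * b) = scalar a * scalar b"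
  "scalar 1 = 1" "scalar 0 = 0"
  by (simp_all add: scalar_def single_add mult_single)

interpretation scale: vector_space "scale :: 'k::field \<Rightarrow> ('a, 'k) free_algebra \<Rightarrow> _"
  by standard (simp_all add: scale_def scalar_simps algebra_simps)

lemma mult_scale [simp]:
  fixes u v :: "('a, 'k::field) free_algebra"
  shows "scale c u * v = scale c (u * v)" and "u * scale c v = scale c (u * v)"
proof -
  have "u * (scalar c * v) = scalar c * (u * v)"
    by (simp add: scalar_commute[of c u] flip: mult.assoc)
  then show "u * scale c v = scale c (u * v)" by (simp add: scale_def)
qed (simp add: scale_def mult.assoc)

lemma scalar_eq_scale_one: "scalar c = scale c 1"
  by (simp add: scale_def)

lemma (in linear_action) free_act_scale_left:
  "free_act \<rho> (scale c u) f p = c * free_act \<rho> u f p"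
  by (simp add: scale_def free_act_mult)

abbreviation GX :: "(generator, 'k::field) free_algebra"
  where "GX \<equiv> gen Gen_x"
abbreviation GY :: "(generator, 'k::field) free_algebra"
  where "GY \<equiv> gen Gen_y"

context
  fixes q :: "'k::field"
begin

abbreviation J where "J \<equiv> woronowicz_ideal q"

lemma
  shows ideal_zero: "0 \<in> J"
    and ideal_add: "\<And>u v. u \<in> J \<Longrightarrow> v \<in> J \<Longrightarrow> u + v \<in> J"
    and ideal_mult_left: "\<And>u v. u \<in> J \<Longrightarrow> v * u \<in> J"
    and ideal_mult_right: "\<And>u v. u \<in> J \<Longrightarrow> u * v \<in> J"
    and relators_subset_ideal: "woronowicz_relators q \<subseteq> J"
proof -
  interpret ideal J ring_of_type_algebra by (rule ideal_woronowicz_ideal)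
  show "0 \<in> J"
    using additive_subgroup.zero_closed[OF is_additive_subgroup] by (simp add: ring_of_type_algebra_def)
  show "u + v \<in> J" if "u \<in> J" "v \<in> J" for u v
    using additive_subgroup.a_closed[OF is_additive_subgroup that] by (simp add: ring_of_type_algebra_def)
  show "v * u \<in> J" "u * v \<in> J" if "u \<in> J" for u v
    using I_l_closed[OF that, of v] I_r_closed[OF that, of v]
    by (simp_all add: ring_of_type_algebra_def)
  show "woronowicz_relators q \<subseteq> J"
    unfolding woronowicz_ideal_def
    by (rule genideal_self) (simp add: ring_of_type_algebra_def)
qed

lemma ideal_scale: "u \<in> J \<Longrightarrow> scale c u \<in> J"
  unfolding scale_def by (rule ideal_mult_left)

lemma ideal_diff: "u \<in> J \<Longrightarrow> v \<in> J \<Longrightarrow> u - v \<in> J"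
  using ideal_add[of u "- v"] ideal_scale[of v "- 1"] by simp

definition wor_cong (infix "\<approx>" 50) where "u \<approx> v \<longleftrightarrow> u - v \<in> J"

lemma cong_refl [simp, intro]: "u \<approx> u"
  by (simp add: wor_cong_def ideal_zero)

lemma cong_sym: "u \<approx> v \<Longrightarrow> v \<approx> u"
  unfolding wor_cong_def using ideal_diff[OF ideal_zero, of "u - v"] by simp

lemma cong_trans [trans]: "u \<approx> v \<Longrightarrow> v \<approx> t \<Longrightarrow> u \<approx> t"
  unfolding wor_cong_def using ideal_add[of "u - v" "v - t"] by simp

lemma cong_add: "u \<approx> u' \<Longrightarrow> v \<approx> v' \<Longrightarrow> u + v \<approx> u' + v'"
  unfolding wor_cong_def using ideal_add[of "u - u'" "v - v'"] by (simp add: algebra_simps)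

lemma cong_diff: "u \<approx> u' \<Longrightarrow> v \<approx> v' \<Longrightarrow> u - v \<approx> u' - v'"
  unfolding wor_cong_def using ideal_diff[of "u - u'" "v - v'"] by (simp add: algebra_simps)

lemma cong_scale: "u \<approx> u' \<Longrightarrow> scale c u \<approx> scale c u'"
  unfolding wor_cong_def using ideal_scale[of "u - u'" c] by (simp add: scale.scale_right_diff_distrib)

lemma cong_mult: "u \<approx> u' \<Longrightarrow> v \<approx> v' \<Longrightarrow> u * v \<approx> u' * v'"
  unfolding wor_cong_def
  using ideal_add[OF ideal_mult_right[of "u - u'" v] ideal_mult_left[of "v - v'" u']]
  by (simp add: algebra_simps)

lemmas cong_intros = cong_add cong_diff cong_scale cong_mult cong_refl

lemma skew_commute_power_right:
  assumes "a * b \<approx> scale c (b * a)"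
  shows "a * b ^ k \<approx> scale (c ^ k) (b ^ k * a)"
proof (induction k)
  case (Suc k)
  have "a * b ^ Suc k = (a * b) * b ^ k" by (simp add: mult.assoc)
  also have "\<dots> \<approx> scale c (b * a) * b ^ k" by (intro cong_intros assms)
  also have "scale c (b * a) * b ^ k = scale c b * (a * b ^ k)" by (simp add: mult.assoc)
  also have "\<dots> \<approx> scale c b * scale (c ^ k) (b ^ k * a)" by (intro cong_intros Suc)
  finally show ?case by (simp add: mult.assoc mult.commute[of c])
qed simp

lemma skew_commute_power_left:
  assumes "a * b \<approx> scale c (b * a)"
  shows "a ^ k * b \<approx> scale (c ^ k) (b * a ^ k)"
proof (induction k)
  case (Suc k)
  have "a ^ Suc k * b = a * (a ^ k * b)" by (simp add: mult.assoc)
  also have "\<dots> \<approx> a * scale (c ^ k) (b * a ^ k)" by (intro cong_intros Suc)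
  also have "\<dots> = scale (c ^ k) ((a * b) * a ^ k)" by (simp add: mult.assoc)
  also have "\<dots> \<approx> scale (c ^ k) (scale c (b * a) * a ^ k)" by (intro cong_intros assms)
  finally show ?case by (simp add: mult.assoc mult.commute)
qed simp

lemma skew_commute_mult:
  assumes "a * b \<approx> scale c (b * a)" "a * b' \<approx> scale c' (b' * a)"
  shows "a * (b * b') \<approx> scale (c * c') (b * b' * a)"
proof -
  have "a * (b * b') = (a * b) * b'" by (simp add: mult.assoc)
  also have "\<dots> \<approx> scale c (b * a) * b'" by (intro cong_intros assms)
  also have "\<dots> = scale c b * (a * b')" by (simp add: mult.assoc)
  also have "\<dots> \<approx> scale c b * scale c' (b' * a)" by (intro cong_intros assms)
  finally show ?thesis by (simp add: mult.assoc mult.commute)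
qed

section \<open>Normal forms\<close>

definition GW :: "(generator, 'k) free_algebra"
  where "GW = gen Gen_z - scalar (shift q)"

text \<open>For \<open>t = y x + a w + b\<close> the relations turn
  \<open>x t - q\<^sup>2 t x\<close> into \<open>(a (q ^ 4 - q\<^sup>2) + q) w x + (b (1 -
  q\<^sup>2) + q * shift q) x\<close>; both coefficients vanish for the \<open>a\<close> and
  \<open>b\<close> taken here.\<close>

definition GT :: "(generator, 'k) free_algebra"
  where "GT = GY * GX + scale (shift q / q) GW - scalar (q * (shift q)\<^sup>2)"

lemma gen_z_eq: "gen Gen_z = GW + scale (shift q) 1"
  by (simp add: GW_def scale_def)

lemma YX_eq: "GY * GX = GT - scale (shift q / q) GW + scale (q * (shift q)\<^sup>2) 1"
  by (simp add: GT_def scale_def)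

text \<open>Since \<open>y x\<close> and \<open>x y\<close> reduce to \<open>t\<close> and
  \<open>w\<close>, \<open>x\<close> and \<open>y\<close> need not occur together. One integer
  records both exponents: truncation by \<open>nat\<close> makes at least one outer power
  trivial.\<close>

definition pbw :: "int \<times> nat \<times> nat \<Rightarrow> (generator, 'k) free_algebra"
  where "pbw = (\<lambda>(n, i, j). GY ^ nat (- n) * GT ^ i * GW ^ j * GX ^ nat n)"

context
  assumes q0: "q \<noteq> 0" and q2: "q\<^sup>2 \<noteq> 1"
begin

section \<open>Commutation rules for x, y, t and w modulo the relations\<close>

lemmas shift_eqs = shift_identities[OF q0 q2]

lemma X_W: "GX * GW \<approx> scale (q ^ 4) (GW * GX)"
proof -
  have "GX * GW - scale (q ^ 4) (GW * GX)
    = GX * gen Gen_z - scalar (q ^ 4) * gen Gen_z * GX - scalar (1 + q\<^sup>2) * GX"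
    unfolding shift_eqs(1)[symmetric] gen_z_eq
    by (simp add: scalar_eq_scale_one algebra_simps)
  also have "\<dots> \<in> J" using relators_subset_ideal by (auto simp: woronowicz_relators_def Let_def)
  finally show ?thesis by (simp add: wor_cong_def)
qed

lemma W_Y: "GW * GY \<approx> scale (q ^ 4) (GY * GW)"
proof -
  have "GW * GY - scale (q ^ 4) (GY * GW)
    = gen Gen_z * GY - scalar (q ^ 4) * GY * gen Gen_z - scalar (1 + q\<^sup>2) * GY"
    unfolding shift_eqs(1)[symmetric] gen_z_eq
    by (simp add: scalar_eq_scale_one algebra_simps)
  also have "\<dots> \<in> J" using relators_subset_ideal by (auto simp: woronowicz_relators_def Let_def)
  finally show ?thesis by (simp add: wor_cong_def)
qed

text \<open>This is \<open>q\<^sup>2 y x + q z\<close> expanded in \<open>t\<close>,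
  \<open>w\<close> and \<open>1\<close>, its coefficients simplified by the last two shift
  identities.\<close>

lemma X_Y: "GX * GY \<approx> scale (q\<^sup>2) GT - scale (shift q / q * q ^ 4) GW + scale (q * (shift q)\<^sup>2) 1"
proof -
  define e where "e = q * (shift q)\<^sup>2"
  have e: "scale e (1 :: (generator, 'k) free_algebra) = scale (q\<^sup>2 * e) 1 + scale (q * shift q) 1"
    unfolding scale.scale_left_distrib[symmetric] using shift_eqs(3) by (simp add: e_def)
  have "GX * GY - (scale (q\<^sup>2) GT - scale (shift q / q * q ^ 4) GW + scale (q * (shift q)\<^sup>2) 1)
    = GX * GY - scalar (q\<^sup>2) * GY * GX - scalar q * gen Gen_z"
    unfolding gen_z_eq shift_eqs(2) mult.assoc[of _ GY GX] YX_eq e_def[symmetric]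
    by (simp add: scalar_eq_scale_one algebra_simps)
      (use e in \<open>simp add: algebra_simps\<close>)
  also have "\<dots> \<in> J" using relators_subset_ideal by (auto simp: woronowicz_relators_def Let_def)
  finally show ?thesis by (simp add: wor_cong_def)
qed

lemma X_T: "GX * GT \<approx> scale (q\<^sup>2) (GT * GX)"
proof -
  have "GX * GT = (GX * GY) * GX + scale (shift q / q) (GX * GW) - scale (q * (shift q)\<^sup>2) GX"
    by (simp add: GT_def scalar_eq_scale_one algebra_simps)
  also have "\<dots> \<approx>
      (scale (q\<^sup>2) GT - scale (shift q / q * q ^ 4) GW + scale (q * (shift q)\<^sup>2) 1) * GX
      + scale (shift q / q) (scale (q ^ 4) (GW * GX)) - scale (q * (shift q)\<^sup>2) GX"
    by (intro cong_intros X_Y X_W)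
  also have "\<dots> = scale (q\<^sup>2) (GT * GX)"
    by (simp add: algebra_simps)
  finally show ?thesis .
qed

lemma T_Y: "GT * GY \<approx> scale (q\<^sup>2) (GY * GT)"
proof -
  have "GT * GY = GY * (GX * GY) + scale (shift q / q) (GW * GY) - scale (q * (shift q)\<^sup>2) GY"
    by (simp add: GT_def scalar_eq_scale_one algebra_simps)
  also have "\<dots> \<approx>
      GY * (scale (q\<^sup>2) GT - scale (shift q / q * q ^ 4) GW + scale (q * (shift q)\<^sup>2) 1)
      + scale (shift q / q) (scale (q ^ 4) (GY * GW)) - scale (q * (shift q)\<^sup>2) GY"
    by (intro cong_intros X_Y W_Y)
  also have "\<dots> = scale (q\<^sup>2) (GY * GT)"
    by (simp add: algebra_simps)
  finally show ?thesis .
qed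

text \<open>\<open>w\<close> commutes with \<open>y x\<close>: the factor \<open>q ^ 4\<close>
  gained in passing \<open>y\<close> is absorbed in passing \<open>x\<close>.\<close>

lemma W_T: "GW * GT \<approx> GT * GW"
proof -
  have "GW * GT = (GW * GY) * GX + scale (shift q / q) (GW * GW) - scale (q * (shift q)\<^sup>2) GW"
    by (simp add: GT_def scalar_eq_scale_one algebra_simps)
  also have "\<dots> \<approx> scale (q ^ 4) (GY * GW) * GX + scale (shift q / q) (GW * GW)
      - scale (q * (shift q)\<^sup>2) GW"
    by (intro cong_intros W_Y)
  also have "\<dots> = GY * scale (q ^ 4) (GW * GX) + scale (shift q / q) (GW * GW)
      - scale (q * (shift q)\<^sup>2) GW"
    by (simp add: mult.assoc)
  also have "\<dots> \<approx> GY * (GX * GW) + scale (shift q / q) (GW * GW) - scale (q * (shift q)\<^sup>2) GW"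
    by (intro cong_intros cong_sym[OF X_W])
  also have "\<dots> = GT * GW"
    by (simp add: GT_def scalar_eq_scale_one algebra_simps)
  finally show ?thesis .
qed

section \<open>Multiplying normal monomials by w, t, x and y\<close>

lemma W_pbw: "GW * pbw (n, i, j) \<approx> scale ((q ^ 4) ^ nat (- n)) (pbw (n, i, Suc j))"
proof -
  have "GW * GT ^ i \<approx> scale (1 ^ i) (GT ^ i * GW)"
    by (rule skew_commute_power_right) (simp add: W_T)
  from skew_commute_mult[OF skew_commute_power_right[OF W_Y, of "nat (- n)"] this]
  have "GW * (GY ^ nat (- n) * GT ^ i)
      \<approx> scale ((q ^ 4) ^ nat (- n)) (GY ^ nat (- n) * GT ^ i * GW)" by simp
  from cong_mult[OF this cong_refl[of "GW ^ j * GX ^ nat n"]]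
  show ?thesis by (simp add: pbw_def mult.assoc)
qed

lemma T_pbw: "GT * pbw (n, i, j) \<approx> scale ((q\<^sup>2) ^ nat (- n)) (pbw (n, Suc i, j))"
  using cong_mult[OF skew_commute_power_right[OF T_Y, of "nat (- n)"]
      cong_refl[of "GT ^ i * GW ^ j * GX ^ nat n"]]
  by (simp add: pbw_def mult.assoc)

lemma pbw_W: "pbw (n, i, j) * GW \<approx> scale ((q ^ 4) ^ nat n) (pbw (n, i, Suc j))"
  using cong_mult[OF cong_refl[of "GY ^ nat (- n) * GT ^ i * GW ^ j"]
      skew_commute_power_left[OF X_W, of "nat n"]]
  by (simp add: pbw_def mult.assoc power_Suc2 del: power_Suc)

lemma X_pbw_nonneg:
  assumes "n \<ge> 0"
  shows "GX * pbw (n, i, j) \<approx> scale ((q\<^sup>2) ^ i * (q ^ 4) ^ j) (pbw (n + 1, i, j))"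
  using cong_mult[OF skew_commute_mult[OF skew_commute_power_right[OF X_T, of i]
        skew_commute_power_right[OF X_W, of j]] cong_refl[of "GX ^ nat n"]] assms
  by (simp add: pbw_def mult.assoc nat_add_distrib)

text \<open>\<open>x\<close> meets one \<open>y\<close>, and \<open>X_Y\<close> replaces the pair.
  The resulting \<open>GT\<close> and \<open>GW\<close> stay on the left, for \<open>T_pbw\<close>
  and \<open>W_pbw\<close> to move.\<close>

lemma X_pbw_neg:
  assumes "n < 0"
  shows "GX * pbw (n, i, j) \<approx> scale (q\<^sup>2) (GT * pbw (n + 1, i, j))
    - scale (shift q / q * q ^ 4) (GW * pbw (n + 1, i, j))
    + scale (q * (shift q)\<^sup>2) (pbw (n + 1, i, j))"
proof -
  have "nat (- n) = Suc (nat (- (n + 1)))" "nat n = nat (n + 1)" using assms by auto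
  then have "GX * pbw (n, i, j) = (GX * GY) * pbw (n + 1, i, j)"
    by (simp add: pbw_def mult.assoc)
  with cong_mult[OF X_Y cong_refl[of "pbw (n + 1, i, j)"]]
  show ?thesis by (simp add: algebra_simps)
qed

lemma Y_pbw_nonpos:
  assumes "n \<le> 0"
  shows "GY * pbw (n, i, j) = pbw (n - 1, i, j)"
proof -
  have "nat (- (n - 1)) = Suc (nat (- n))" "nat n = nat (n - 1)" using assms by auto
  then show ?thesis by (simp add: pbw_def mult.assoc)
qed

text \<open>Instead of moving \<open>y\<close> past \<open>t\<close> and \<open>w\<close>,
  \<open>pbw (n, i, j)\<close> is rewritten as a multiple of \<open>GX * pbw (n - 1, i, j)\<close>,
  so that \<open>y\<close> meets \<open>x\<close> directly.\<close>

lemma Y_pbw_pos: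
  assumes "n > 0"
  shows "GY * pbw (n, i, j) \<approx> scale (1 / ((q\<^sup>2) ^ i * (q ^ 4) ^ j))
    (GT * pbw (n - 1, i, j) - scale (shift q / q) (GW * pbw (n - 1, i, j))
     + scale (q * (shift q)\<^sup>2) (pbw (n - 1, i, j)))"
proof -
  have "GX * pbw (n - 1, i, j) \<approx> scale ((q\<^sup>2) ^ i * (q ^ 4) ^ j) (pbw (n, i, j))"
    using X_pbw_nonneg[of "n - 1"] assms by simp
  from cong_sym[OF cong_scale[OF cong_mult[OF cong_refl[of GY] this],
        of "1 / ((q\<^sup>2) ^ i * (q ^ 4) ^ j)"]]
  have "GY * pbw (n, i, j) \<approx> scale (1 / ((q\<^sup>2) ^ i * (q ^ 4) ^ j)) ((GY * GX) * pbw (n - 1, i, j))"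
    using q0 by (simp add: mult.assoc)
  then show ?thesis by (simp add: YX_eq algebra_simps)
qed

section \<open>The normal monomials span the algebra modulo the ideal\<close>

abbreviation L where "L \<equiv> scale.span (J \<union> range pbw)"

lemma pbw_in_span: "pbw s \<in> L"
  by (intro scale.span_base) auto

lemma span_wor_cong:
  assumes "u \<approx> v" "v \<in> L"
  shows "u \<in> L"
proof -
  have "u - v \<in> L" using assms(1) by (intro scale.span_base) (simp add: wor_cong_def)
  from scale.span_add[OF this assms(2)] show ?thesis by simp
qed

lemma span_mult_left:
  assumes g: "\<And>s. g * pbw s \<in> L" and v: "v \<in> L"
  shows "g * v \<in> L"
  using v
proof (induction rule: scale.span_induct_alt)
  case base
  show ?case by (simp add: scale.span_zero)
next
  case (step c x y)
  have "g * x \<in> L"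
    using step(1)
  proof
    assume "x \<in> J"
    then show ?thesis by (auto intro: scale.span_base ideal_mult_left)
  qed (use g in auto)
  with step(2) show ?case
    by (simp add: distrib_left scale.span_add scale.span_scale)
qed

lemma span_gen_mult: "gen g * v \<in> L" if v: "v \<in> L"
proof -
  have W: "GW * pbw s \<in> L" for s
    by (cases s) (auto intro: span_wor_cong[OF W_pbw] scale.span_scale pbw_in_span)
  have T: "GT * pbw s \<in> L" for s
    by (cases s) (auto intro: span_wor_cong[OF T_pbw] scale.span_scale pbw_in_span)
  note span = scale.span_scale scale.span_add scale.span_diff pbw_in_span W T
  have X: "GX * pbw s \<in> L" for s
  proof (cases s)
    case (fields n i j)
    show ?thesis
    proof (cases "n \<ge> 0")
      case True
      then show ?thesis unfolding fields
        by (rule span_wor_cong[OF X_pbw_nonneg]) (intro span)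
    next
      case False
      then show ?thesis unfolding fields
        by (intro span_wor_cong[OF X_pbw_neg] span) simp
    qed
  qed
  have Y: "GY * pbw s \<in> L" for s
  proof (cases s)
    case (fields n i j)
    show ?thesis
    proof (cases "n > 0")
      case True
      then show ?thesis unfolding fields
        by (rule span_wor_cong[OF Y_pbw_pos]) (intro span)
    next
      case False
      then show ?thesis unfolding fields
        by (simp add: Y_pbw_nonpos pbw_in_span)
    qed
  qed
  show ?thesis
  proof (cases g)
    case Gen_x
    then show ?thesis using span_mult_left[OF X v] by simp
  next
    case Gen_y
    then show ?thesis using span_mult_left[OF Y v] by simp
  next
    case Gen_z
    then show ?thesis using span_mult_left[OF W v] v
      by (simp add: gen_z_eq distrib_right scale.span_add scale.span_scale)
  qed
qed

lemma pbw_zero: "pbw (0, 0, 0) = 1"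
  by (simp add: pbw_def)

text \<open>\<open>L\<close> contains \<open>1\<close> and is closed under left multiplication by
  generators, hence contains every word. As \<open>J\<close> is among the spanning vectors, this
  expresses spanning of the quotient inside the free algebra.\<close>

lemma span_pbw: "L = UNIV"
proof -
  have word: "Poly_Mapping.single (Word ws) 1 \<in> L" for ws
  proof (induction ws)
    case Nil
    show ?case using pbw_in_span[of "(0, 0, 0)"] by (simp add: pbw_zero flip: zero_free_monoid_def)
  next
    case (Cons g ws)
    have "Poly_Mapping.single (Word (g # ws)) 1 = gen g * Poly_Mapping.single (Word ws) (1 :: 'k)"
      by (simp add: gen_def mult_single plus_free_monoid_def)
    with span_gen_mult[OF Cons] show ?case by simp
  qed
  have "u \<in> L" for u
  proof (induction u rule: free_algebra_induct)
    case (single w c)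
    have "Poly_Mapping.single w c = scale c (Poly_Mapping.single (Word (letters w)) 1)"
      by (simp add: scale_def scalar_def mult_single)
    with scale.span_scale[OF word] show ?case by metis
  qed (rule scale.span_add)
  then show ?thesis by blast
qed

lemma normal_form:
  obtains S c where "finite S" "u \<approx> (\<Sum>s\<in>S. scale (c s) (pbw s))"
proof -
  have "u \<in> L" by (simp add: span_pbw)
  then obtain v b where u: "u = v + b" and v: "v \<in> scale.span J" and b: "b \<in> scale.span (range pbw)"
    by (auto simp: scale.span_Un)
  have "scale.subspace J"
    by (intro scale.subspaceI ideal_zero ideal_add ideal_scale)
  with v have "v \<in> J" using scale.span_eq_iff by metis
  from b obtain t r where t: "finite t" "t \<subseteq> range pbw" and b: "b = (\<Sum>a\<in>t. scale (r a) a)"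
    by (auto simp: scale.span_explicit)
  \<comment> \<open>Choosing one index per vector makes \<open>pbw\<close> injective on
    \<open>S\<close>, so that the sum can be reindexed.\<close>
  from t(2) obtain S where S: "inj_on pbw S" "t = pbw ` S"
    using subset_image_inj by metis
  show ?thesis
  proof
    show "finite S" using t(1) S finite_image_iff by blast
    show "u \<approx> (\<Sum>s\<in>S. scale (r (pbw s)) (pbw s))"
      using \<open>v \<in> J\<close> by (simp add: u b S sum.reindex wor_cong_def)
  qed
qed

section \<open>Central elements\<close>

definition delta :: "int \<times> int \<times> int \<Rightarrow> int \<times> int \<times> int \<Rightarrow> 'k"
  where "delta s p = of_bool (p = s)"

text \<open>The kernel of the action is an ideal containing the relators, hence contains
  \<open>J\<close>: the action descends to the quotient.\<close>

lemma free_act_cong: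
  assumes "u \<approx> v"
  shows "free_act (wor_act q) u = free_act (wor_act q) v"
proof -
  interpret R: ring "ring_of_type_algebra :: (generator, 'k) free_algebra ring"
    by (rule ring_ring_of_type_algebra)
  have "J \<subseteq> {u. \<forall>f p. free_act (wor_act q) u f p = 0}"
    unfolding woronowicz_ideal_def
    by (rule R.genideal_minimal[OF wor.ideal_free_act_kernel])
      (use wor_act_relators[OF q0 q2] in blast)
  with assms show ?thesis
    by (auto simp: wor_cong_def wor.free_act_diff fun_eq_iff)
qed

lemma act_GW: "free_act (wor_act q) GW f (n, i, j)
    = (if n < 0 then q powi (- 4 * n) else 1) * f (n, i, j - 1)"
  by (simp add: GW_def wor.free_act_diff)

lemma act_GT: "free_act (wor_act q) GT f (n, i, j)
    = wor_act q Gen_y (wor_act q Gen_x f) (n, i, j)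
      + shift q / q * free_act (wor_act q) GW f (n, i, j) - q * (shift q)\<^sup>2 * f (n, i, j)"
  by (simp add: GT_def wor.free_act_diff wor.free_act_add wor.free_act_mult wor.free_act_scale_left
    del: wor_act.simps)

text \<open>For \<open>n < 0\<close>, moving \<open>t\<close> past powers of \<open>y\<close> would
  cost a power of \<open>q\<close>. The case \<open>n \<ge> 0\<close> suffices because in
  \<open>pbw\<close> the factors \<open>t\<close> act before any \<open>y\<close>.\<close>

lemma act_GT_delta:
  assumes "n \<ge> 0"
  shows "free_act (wor_act q) GT (delta (n, i, j)) = delta (n, i + 1, j)"
proof
  fix p :: "int \<times> int \<times> int"
  obtain n' i' j' where p: "p = (n', i', j')" by (cases p)
  show "free_act (wor_act q) GT (delta (n, i, j)) p = delta (n, i + 1, j) p"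
  proof (cases "n' < 0")
    case True
    with assms show ?thesis by (simp add: p act_GT act_GW delta_def)
  next
    case False
    then show ?thesis
      by (auto simp add: p act_GT act_GW wor_act_YX[OF q0] delta_def simp del: wor_act.simps)
  qed
qed

text \<open>\<open>delta (0, 0, 0)\<close> is the coordinate vector of \<open>1\<close>, so acting
  on it reads off coordinates. Distinct indices give distinct unit vectors, whence linear
  independence.\<close>

lemma act_pbw: "free_act (wor_act q) (pbw (n, i, j)) (delta (0, 0, 0)) = delta (n, int i, int j)"
proof -
  have X: "free_act (wor_act q) (GX ^ k) (delta (0, 0, 0)) = delta (int k, 0, 0)" for k
    by (induction k) (auto simp: wor.free_act_mult fun_eq_iff delta_def)
  have W: "free_act (wor_act q) (GW ^ k) (delta (int m, 0, 0)) = delta (int m, 0, int k)" for k m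
    by (induction k) (auto simp: wor.free_act_mult fun_eq_iff delta_def act_GW)
  have T: "free_act (wor_act q) (GT ^ k) (delta (int m, 0, l)) = delta (int m, int k, l)" for k l m
    by (induction k) (simp_all add: wor.free_act_mult act_GT_delta add.commute)
  have Y: "free_act (wor_act q) (GY ^ k) (delta (0, a, b)) = delta (- int k, a, b)" for k a b
    by (induction k) (auto simp: wor.free_act_mult fun_eq_iff delta_def)
  show ?thesis
  proof (cases "n \<ge> 0")
    case True
    then obtain m where "n = int m" by (rule nonneg_int_cases)
    then show ?thesis by (simp add: pbw_def wor.free_act_mult X W T)
  next
    case False
    then show ?thesis
      using W[of j 0] T[of i 0 "int j"] Y[of "nat (- n)"] by (simp add: pbw_def wor.free_act_mult)
  qed
qed

lemma act_sum_pbw: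
  assumes "finite S" "inj_on h S" "t \<in> S" "h t = (n, i, j)"
  shows "free_act (wor_act q) (\<Sum>s\<in>S. scale (c s) (pbw (h s))) (delta (0, 0, 0)) (n, int i, int j) = c t"
proof -
  have "free_act (wor_act q) (\<Sum>s\<in>S. scale (c s) (pbw (h s))) (delta (0, 0, 0)) (n, int i, int j)
      = (\<Sum>s\<in>S. c s * of_bool (s = t))"
    unfolding wor.free_act_sum
  proof (rule sum.cong)
    fix s assume s: "s \<in> S"
    obtain n' i' j' where h: "h s = (n', i', j')" by (cases "h s")
    have "s = t \<longleftrightarrow> h s = h t" using inj_on_eq_iff[OF assms(2) s assms(3)] by simp
    then show "free_act (wor_act q) (scale (c s) (pbw (h s))) (delta (0, 0, 0)) (n, int i, int j)
        = c s * of_bool (s = t)"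
      by (auto simp add: wor.free_act_scale_left h act_pbw delta_def assms(4))
  qed simp
  also have "\<dots> = c t" using assms by (simp add: of_bool_def if_distrib cong: if_cong)
  finally show ?thesis .
qed

section \<open>Coefficients of a central element\<close>

lemma cong_sum: "(\<And>s. s \<in> S \<Longrightarrow> f s \<approx> g s) \<Longrightarrow> (\<Sum>s\<in>S. f s) \<approx> (\<Sum>s\<in>S. g s)"
  by (induction S rule: infinite_finite_induct) (auto intro: cong_add)

text \<open>Multiplication by \<open>g\<close> on either side moves normal monomials, up to
  constants, along the same injective \<open>h\<close>; by linear independence the resulting
  coefficients agree.\<close>

lemma commuting_coefficients:
  assumes u: "u \<approx> (\<Sum>s\<in>S. scale (c s) (pbw s))" and "u * g \<approx> g * u"
    and S: "finite S" "inj_on h S"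
    and a: "\<And>s. s \<in> S \<Longrightarrow> pbw s * g \<approx> scale (a s) (pbw (h s))"
    and b: "\<And>s. s \<in> S \<Longrightarrow> g * pbw s \<approx> scale (b s) (pbw (h s))"
    and t: "t \<in> S"
  shows "c t * a t = c t * b t"
proof -
  let ?N = "\<Sum>s\<in>S. scale (c s) (pbw s)"
  have "?N * g \<approx> (\<Sum>s\<in>S. scale (c s * a s) (pbw (h s)))"
    unfolding sum_distrib_right using cong_scale[OF a] by (intro cong_sum) fastforce
  moreover have "g * ?N \<approx> (\<Sum>s\<in>S. scale (c s * b s) (pbw (h s)))"
    unfolding sum_distrib_left using cong_scale[OF b] by (intro cong_sum) fastforce
  moreover have "?N * g \<approx> g * ?N"
    using u \<open>u * g \<approx> g * u\<close> by (meson cong_mult cong_refl cong_sym cong_trans)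
  ultimately have
    "(\<Sum>s\<in>S. scale (c s * a s) (pbw (h s))) \<approx> (\<Sum>s\<in>S. scale (c s * b s) (pbw (h s)))"
    by (meson cong_sym cong_trans)
  note eq = free_act_cong[OF this]
  obtain n i j where h: "h t = (n, i, j)" by (cases "h t")
  from act_sum_pbw[OF S t h, of "\<lambda>s. c s * a s"] act_sum_pbw[OF S t h, of "\<lambda>s. c s * b s"] eq
  show ?thesis by metis
qed

lemma central_imp_scalar:
  assumes root: "\<forall>n::nat. n > 0 \<longrightarrow> q ^ n \<noteq> 1" and central: "\<And>v. u * v \<approx> v * u"
  shows "\<exists>c. u \<approx> scalar c"
proof -
  obtain S c where S: "finite S" and u: "u \<approx> (\<Sum>s\<in>S. scale (c s) (pbw s))"
    using normal_form by blast
  have c_n: "c (n, i, j) = 0" if s: "(n, i, j) \<in> S" and "n \<noteq> 0" for n i j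
  proof -
    have "c (n, i, j) * (\<lambda>(n, i, j). (q ^ 4) ^ nat n) (n, i, j)
        = c (n, i, j) * (\<lambda>(n, i, j). (q ^ 4) ^ nat (- n)) (n, i, j)"
      using pbw_W W_pbw
      by (intro commuting_coefficients[OF u central S,
          where h = "\<lambda>(n, i, j). (n, i, Suc j)" and g = "GW"] s)
        (auto simp: inj_on_def)
    \<comment> \<open>Here \<open>max n (- n)\<close> is the absolute value of \<open>n\<close>. One
      of the two factors above is \<open>1\<close> and the other is this power.\<close>
    moreover have "(q ^ 4) ^ nat (max n (- n)) \<noteq> 1"
      using root[rule_format, of "4 * nat (max n (- n))"] \<open>n \<noteq> 0\<close> by (simp add: power_mult)
    ultimately show ?thesis
      by (cases "n > 0") (auto simp: max_def split: if_splits)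
  qed
  define S0 where "S0 = {s \<in> S. fst s = 0}"
  have S0: "finite S0" using S by (simp add: S0_def)
  have "(\<Sum>s\<in>S. scale (c s) (pbw s)) = (\<Sum>s\<in>S0. scale (c s) (pbw s))"
  proof (intro sum.mono_neutral_right S ballI)
    fix s assume "s \<in> S - S0"
    with c_n show "scale (c s) (pbw s) = 0" by (cases s) (simp add: S0_def)
  qed (auto simp: S0_def)
  with u have u0: "u \<approx> (\<Sum>s\<in>S0. scale (c s) (pbw s))" by simp
  have c_ij: "c (n, i, j) = 0" if s: "(n, i, j) \<in> S0" and ij: "(i, j) \<noteq> (0, 0)" for n i j
  proof -
    \<comment> \<open>On \<open>S0\<close> there are no powers of \<open>y\<close> or
      \<open>x\<close>: from the right \<open>x\<close> joins at no cost, from the left it passes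
      all \<open>t\<close> and \<open>w\<close>.\<close>
    have "c (n, i, j) * 1 = c (n, i, j) * (\<lambda>(n, i, j). (q\<^sup>2) ^ i * (q ^ 4) ^ j) (n, i, j)"
    proof (rule commuting_coefficients[OF u0 central S0,
          where h = "\<lambda>(n, i, j). (n + 1, i, j)" and g = GX])
      fix s assume "s \<in> S0"
      then obtain i j where s: "s = (0, i, j)" by (cases s) (auto simp: S0_def)
      show "pbw s * GX \<approx> scale 1 (pbw ((\<lambda>(n, i, j). (n + 1, i, j)) s))"
        by (simp add: s pbw_def)
      show "GX * pbw s \<approx> scale ((\<lambda>(n, i, j). (q\<^sup>2) ^ i * (q ^ 4) ^ j) s)
          (pbw ((\<lambda>(n, i, j). (n + 1, i, j)) s))"
        using X_pbw_nonneg[of 0 i j] by (simp add: s)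
    qed (auto simp: inj_on_def s)
    moreover have "(q\<^sup>2) ^ i * (q ^ 4) ^ j \<noteq> 1"
      using root[rule_format, of "2 * i + 4 * j"] ij by (auto simp: power_add power_mult)
    ultimately show ?thesis by auto
  qed
  have "(\<Sum>s\<in>S0. scale (c s) (pbw s)) = (\<Sum>s\<in>S0 \<inter> {(0, 0, 0)}. scale (c s) (pbw s))"
  proof (intro sum.mono_neutral_right S0 ballI)
    fix s assume "s \<in> S0 - S0 \<inter> {(0, 0, 0)}"
    with c_ij show "scale (c s) (pbw s) = 0" by (cases s) (auto simp: S0_def)
  qed auto
  \<comment> \<open>If \<open>(0, 0, 0)\<close> is not in \<open>S0\<close>, the sum is empty and
    the scalar is \<open>0\<close>.\<close>
  also have "\<dots> = scalar (if (0, 0, 0) \<in> S0 then c (0, 0, 0) else 0)"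
    by (auto simp: pbw_zero scalar_eq_scale_one)
  finally show ?thesis using u0 by auto
qed

text \<open>A scalar acts as multiplication by itself, which is visible on the constant function
  \<open>1\<close>; so no nonzero scalar lies in the ideal.\<close>

lemma scalar_cong_imp_eq:
  assumes "scalar a \<approx> scalar b"
  shows "a = b"
  using fun_cong[OF fun_cong[OF free_act_cong[OF assms]], of "\<lambda>_. 1" undefined] by simp

end
end

section \<open>From congruences to the quotient ring\<close>

abbreviation coset :: "'k::field \<Rightarrow> (generator, 'k) free_algebra \<Rightarrow> (generator, 'k) free_algebra set"
  where "coset q u \<equiv> woronowicz_ideal q +>\<^bsub>ring_of_type_algebra\<^esub> u"

lemma coset_eq_iff:
  "coset q u = coset q v \<longleftrightarrow> wor_cong q u v"
proof -
  interpret R: ring "ring_of_type_algebra :: (generator, 'a) free_algebra ring"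
    by (rule ring_ring_of_type_algebra)
  have "\<ominus>\<^bsub>ring_of_type_algebra\<^esub> v = - v"
    by (rule R.minus_equality) (simp_all add: ring_of_type_algebra_def)
  then show ?thesis
    using R.quotient_eq_iff_same_a_r_cos[OF ideal_woronowicz_ideal, of u v q]
    by (simp add: wor_cong_def a_minus_def) (simp add: ring_of_type_algebra_def)
qed

lemma carrier_woronowicz:
  "carrier (woronowicz q) = range (coset q)"
  by (auto simp: woronowicz_def FactRing_def A_RCOSETS_def' ring_of_type_algebra_def)

lemma coset_mult:
  "coset q u \<otimes>\<^bsub>woronowicz q\<^esub> coset q v = coset q (u * v)"
  using ring_hom_mult[OF ideal.rcos_ring_hom[OF ideal_woronowicz_ideal], of u v q]
  by (simp add: woronowicz_def) (simp add: ring_of_type_algebra_def)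

theorem theorem3p2:
  fixes q :: "'k::field_char_0"
  assumes "q \<noteq> 0"
    and "\<forall>n::nat. n > 0 \<longrightarrow> q ^ n \<noteq> 1"
  shows "inj (woronowicz_scalar q) \<and> ring_center (woronowicz q) = range (woronowicz_scalar q)"
proof
  have q2: "q\<^sup>2 \<noteq> 1" using assms(2) by simp
  show "inj (woronowicz_scalar q)"
    by (rule injI) (simp add: woronowicz_scalar_def coset_eq_iff scalar_cong_imp_eq[OF assms(1) q2])
  have central: "(\<forall>v. wor_cong q (u * v) (v * u)) \<longleftrightarrow> (\<exists>c. wor_cong q u (scalar c))" for u
  proof
    assume "\<exists>c. wor_cong q u (scalar c)"
    then obtain c where c: "wor_cong q u (scalar c)" ..
    show "\<forall>v. wor_cong q (u * v) (v * u)"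
    proof
      fix v
      have "wor_cong q (u * v) (scalar c * v)" by (intro cong_mult c cong_refl)
      also have "scalar c * v = v * scalar c" by (rule scalar_commute)
      also have "wor_cong q \<dots> (v * u)" by (intro cong_mult cong_sym[OF c] cong_refl)
      finally show "wor_cong q (u * v) (v * u)" .
    qed
  qed (use central_imp_scalar[OF assms(1) q2 assms(2)] in blast)
  \<comment> \<open>Every carrier element is a coset, so being central and being a scalar both
    become congruences between representatives, related by \<open>central\<close>.\<close>
  have mem: "coset q u \<in> ring_center (woronowicz q)
      \<longleftrightarrow> coset q u \<in> range (woronowicz_scalar q)" for u
    using cong_refl[of q u]
    by (auto simp: ring_center_def carrier_woronowicz coset_mult coset_eq_iff central
      woronowicz_scalar_def image_iff simp del: cong_refl)
  have sub: "ring_center (woronowicz q) \<subseteq> carrier (woronowicz q)"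
    "range (woronowicz_scalar q) \<subseteq> carrier (woronowicz q)"
    by (auto simp: ring_center_def carrier_woronowicz woronowicz_scalar_def)
  show "ring_center (woronowicz q) = range (woronowicz_scalar q)"
  proof (rule Set.set_eqI)
    fix U
    show "U \<in> ring_center (woronowicz q) \<longleftrightarrow> U \<in> range (woronowicz_scalar q)"
    proof (cases "U \<in> carrier (woronowicz q)")
      case True
      then obtain u where "U = coset q u"
        unfolding carrier_woronowicz by (rule rangeE)
      with mem show ?thesis by metis
    qed (use sub in blast)
  qed
qed

end
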